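(* Let $f=\tilde f'$ and $g=\tilde g'$, and consider the fully-discrete meshless LRBF collocation midpoint method for the nonlinear stochastic wave equation $du_t-u_{xx}\,dt+f(u)\,dt=g(u)\circ dW(t)$ on $[x_L,x_R]$ with homogeneous Dirichlet boundary condition: for $n\ge 0$ and $i=1,\dots,I-1$, $$\frac{U_i^{n+1}-U_i^n}{\Delta t}=V_i^{n+\frac12},\qquad \sum_{k=1}^{n_i}{}_{i}d^{(1)}_k\,{}_{i}U_k^{n+\frac12}=\mathcal W_i^{n+\frac12},$$ $$\frac{V_i^{n+1}-V_i^n}{\Delta t}=\sum_{k=1}^{n_i}{}_{i}d^{(1)}_k\,{}_{i}\mathcal W_k^{n+\frac12}-f\big(U_i^{n+\frac12}\big)+g\big(U_i^{n+\frac12}\big)\frac{\Delta W_i^n}{\Delta t}.$$ Put $Z_i^n=(U_i^n,V_i^n,\mathcal W_i^n)^\top$, $$M=\begin{pmatrix}0&1&0\\-1&0&0\\0&0&0\end{pmatrix},\qquad K=\begin{pmatrix}0&0&-1\\0&0&0\\1&0&0\end{pmatrix},$$ $$\omega_i^n=\tfrac12\,\mathrm dZ_i^n\wedge M\,\mathrm dZ_i^n,\qquad {}_{i}\kappa_k^{n+\frac12}=\mathrm dZ_i^{n+\frac12}\wedge K\,\mathrm d\,{}_{i}Z_k^{n+\frac12}.$$ Then the method admits the discrete multi-symplectic conservation law: almost surely, for all $i=1,\dots,I-1$ and $n\ge0$, $$\frac{\omega_i^{n+1}-\omega_i^n}{\Delta t}+\sum_{k=1}^{n_i}{}_{i}d_k^{(1)}\,{}_{i}\kappa_k^{n+\frac12}=0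 .$$
   Context: Equation: with $v=u_t$, $w=u_x$ the stochastic wave equation reads $du=v\,dt$, $u_x=w$, $dv-w_x\,dt=-f(u)\,dt+g(u)\circ dW(t)$; it is the stochastic Hamiltonian PDE $M\,dz+Kz_x\,dt=\nabla S_1(z)\,dt+\nabla S_2(z)\circ dW$ with $z=(u,v,w)^\top$, $S_1(z)=\frac12(w^2-v^2)-\tilde f(u)$, $S_2(z)=\tilde g(u)$. Here $\tilde f,\tilde g$ are smooth, $f,g$ act pointwise and are globally Lipschitz, and $W$ is an $L^2([x_L,x_R],\mathbb R)$-valued $Q$-Wiener process with $Q$ symmetric, positive definite and of finite trace; $\circ$ is the Stratonovich product. Grid: $x_i=x_L+i\Delta x$ ($0\le i\le I$), $t_n=n\Delta t$, $\Delta W_i^n=W(x_i,t_{n+1})-W(x_i,t_n)$. $U_i^n,V_i^n,\mathcal W_i^n$ approximate $u,v,w$ at $(x_i,t_n)$; a superscript $n+\frac12$ means the average of the values at levels $n$ and $n+1$. LRBF weights: for each interior node $x_i$, let ${}_{i}\Omega=\{{}_{i}x_1,\dots,{}_{i}x_{n_i}\}$ be its influence domain (the $n_i$ nodes nearest to $x_i$, including $x_i$). With a radial basis function $\varphi$ (for instance $\varphi(x)=e^{-c^2x^2}$, $\sqrt{x^2+c^2}$ or $1/\sqrt{x^2+c^2}$) let ${}_{i}\Phi=(\varphi(\|{}_{i}x_j-{}_{i}x_k\|))_{j,k=1}^{n_i}$, assumed invertible; the first-order weights are the row vector $({}_{i}d_1^{(1)},\dots,{}_{i}d_{n_i}^{(1)})=\big(\partial_x\varphi(\|x-{}_{i}x_1\|),\dots,\partial_x\varphi(\|x-{}_{i}x_{n_i}\|)\big)\big|_{x=x_i}\,({}_{i}\Phi)^{-1}$.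 Because of the homogeneous Dirichlet condition, weights attached to nodes that are not interior nodes $x_1,\dots,x_{I-1}$ are set to zero. For a grid quantity $Y$, ${}_{i}Y_k$ denotes its value at the node ${}_{i}x_k$. Differential forms: $\mathrm d$ (roman) is the exterior derivative: for each fixed realization of the noise, numerical solutions are regarded as differentiable functions of parameters (e.g. the data), so their differentials satisfy the linearized scheme and noise increments carry no differential. For vectors $a,b$ of one-forms and a matrix $A$, $a\wedge Ab=\sum_{p,q}A_{pq}\,a_p\wedge b_q$. *)

theory Defs
  imports "HOL-Probability.Probability" "Jordan_Normal_Form.Gauss_Jordan_Elimination"
begin

section \<open>Square-integrable functions and Q-Wiener processes\<close>

text \<open>Elements of \<open>L\<^sup>2([a,b],\<real>)\<close> are represented by functions; equality in \<open>L\<^sup>2\<close> is equality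
  almost everywhere on \<open>[a,b]\<close>.\<close>

definition L2 :: "real \<Rightarrow> real \<Rightarrow> (real \<Rightarrow> real) set" where
  "L2 a b = {h \<in> borel_measurable (lebesgue_on {a..b}).
               integrable (lebesgue_on {a..b}) (\<lambda>x. (h x)\<^sup>2)}"

definition L2_inner :: "real \<Rightarrow> real \<Rightarrow> (real \<Rightarrow> real) \<Rightarrow> (real \<Rightarrow> real) \<Rightarrow> real" where
  "L2_inner a b h k = (LINT x|lebesgue_on {a..b}. h x * k x)"

definition L2_norm :: "real \<Rightarrow> real \<Rightarrow> (real \<Rightarrow> real) \<Rightarrow> real" where
  "L2_norm a b h = sqrt (L2_inner a b h h)"

definition L2_eq :: "real \<Rightarrow> real \<Rightarrow> (real \<Rightarrow> real) \<Rightarrow> (real \<Rightarrow> real) \<Rightarrow> bool" where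
  "L2_eq a b h k \<longleftrightarrow> (AE x in lebesgue_on {a..b}. h x = k x)"

definition L2_open :: "real \<Rightarrow> real \<Rightarrow> (real \<Rightarrow> real) set \<Rightarrow> bool" where
  "L2_open a b S \<longleftrightarrow> S \<subseteq> L2 a b \<and>
     (\<forall>h\<in>S. \<exists>r>0. \<forall>k\<in>L2 a b. L2_norm a b (\<lambda>x. k x - h x) < r \<longrightarrow> k \<in> S)"

definition L2_borel :: "real \<Rightarrow> real \<Rightarrow> (real \<Rightarrow> real) measure" where
  "L2_borel a b = sigma (L2 a b) {S. L2_open a b S}"

definition L2_orthonormal_basis :: "real \<Rightarrow> real \<Rightarrow> (nat \<Rightarrow> real \<Rightarrow> real) \<Rightarrow> bool" where
  "L2_orthonormal_basis a b e \<longleftrightarrow>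
     (\<forall>k. e k \<in> L2 a b) \<and>
     (\<forall>j k. L2_inner a b (e j) (e k) = (if j = k then 1 else 0)) \<and>
     (\<forall>h\<in>L2 a b. (\<forall>k. L2_inner a b h (e k) = 0) \<longrightarrow> L2_eq a b h (\<lambda>_. 0))"

text \<open>A bounded linear operator on \<open>L\<^sup>2([a,b],\<real>)\<close> that is symmetric, positive definite and of
  finite trace. Boundedness and linearity make it well defined on classes.\<close>

definition covariance_operator ::
  "real \<Rightarrow> real \<Rightarrow> ((real \<Rightarrow> real) \<Rightarrow> real \<Rightarrow> real) \<Rightarrow> bool" where
  "covariance_operator a b Q \<longleftrightarrow>
     (\<forall>h\<in>L2 a b. Q h \<in> L2 a b) \<and>
     (\<forall>h\<in>L2 a b. \<forall>k\<in>L2 a b. \<forall>c. L2_eq a b (Q (\<lambda>x. c * h x + k x)) (\<lambda>x. c * Q h x + Q k x)) \<and>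
     (\<exists>C. \<forall>h\<in>L2 a b. L2_norm a b (Q h) \<le> C * L2_norm a b h) \<and>
     (\<forall>h\<in>L2 a b. \<forall>k\<in>L2 a b. L2_inner a b (Q h) k = L2_inner a b h (Q k)) \<and>
     (\<forall>h\<in>L2 a b. \<not> L2_eq a b h (\<lambda>_. 0) \<longrightarrow> L2_inner a b (Q h) h > 0) \<and>
     (\<exists>e. L2_orthonormal_basis a b e \<and> summable (\<lambda>k. L2_inner a b (Q (e k)) (e k)))"

text \<open>\<open>W x t \<omega>\<close> is the value at \<open>x\<close> of a fixed, jointly measurable representative of the
  \<open>L\<^sup>2\<close>-valued random variable \<open>W(t)\<close>, so that the point values used by the scheme make sense.
  The last conjunct states that \<open>W(t) - W(s)\<close> is Gaussian with mean \<open>0\<close> and covariance operator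
  \<open>(t - s) Q\<close>, through its pairings with all nonzero \<open>h\<close>.\<close>

definition Q_Wiener_process ::
  "'w measure \<Rightarrow> real \<Rightarrow> real \<Rightarrow> ((real \<Rightarrow> real) \<Rightarrow> real \<Rightarrow> real)
     \<Rightarrow> (real \<Rightarrow> real \<Rightarrow> 'w \<Rightarrow> real) \<Rightarrow> bool" where
  "Q_Wiener_process P a b Q W \<longleftrightarrow>
     prob_space P \<and>
     (\<forall>t\<ge>0. (\<lambda>(x, \<omega>). W x t \<omega>) \<in> borel_measurable (lebesgue_on {a..b} \<Otimes>\<^sub>M P)) \<and>
     (\<forall>t\<ge>0. \<forall>\<omega>\<in>space P. (\<lambda>x. W x t \<omega>) \<in> L2 a b) \<and>
     (AE \<omega> in P. L2_eq a b (\<lambda>x. W x 0 \<omega>) (\<lambda>_. 0)) \<and>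
     (AE \<omega> in P. \<forall>t\<ge>0.
        ((\<lambda>s. L2_norm a b (\<lambda>x. W x s \<omega> - W x t \<omega>)) \<longlongrightarrow> 0) (at t within {0..})) \<and>
     (\<forall>(m::nat) \<tau>. 0 \<le> \<tau> 0 \<and> strict_mono \<tau> \<longrightarrow>
        prob_space.indep_vars P (\<lambda>_. L2_borel a b)
          (\<lambda>j \<omega> x. W x (\<tau> (Suc j)) \<omega> - W x (\<tau> j) \<omega>) {..<m}) \<and>
     (\<forall>s t. 0 \<le> s \<and> s < t \<longrightarrow>
        (\<forall>h\<in>L2 a b. \<not> L2_eq a b h (\<lambda>_. 0) \<longrightarrow>
           distributed P lborel (\<lambda>\<omega>. L2_inner a b (\<lambda>x. W x t \<omega> - W x s \<omega>) h)
             (normal_density 0 (sqrt ((t - s) * L2_inner a b (Q h) h)))))"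

section \<open>Smooth functions\<close>

definition smooth :: "(real \<Rightarrow> real) \<Rightarrow> bool" where
  "smooth h \<longleftrightarrow> (\<forall>m. (deriv ^^ m) h differentiable_on UNIV)"

section \<open>LRBF weights\<close>

definition grid_point :: "real \<Rightarrow> real \<Rightarrow> nat \<Rightarrow> nat \<Rightarrow> real" where
  "grid_point xL xR I i = xL + real i * ((xR - xL) / real I)"

text \<open>Local nodes are numbered from \<open>0\<close>: \<open>\<nu> k\<close> (\<open>k < n\<close>) is the global index of local node
  number \<open>k + 1\<close>. Ties in ``nearest'' may be broken arbitrarily.\<close>

definition influence_domain :: "(nat \<Rightarrow> real) \<Rightarrow> nat \<Rightarrow> nat \<Rightarrow> nat \<Rightarrow> (nat \<Rightarrow> nat) \<Rightarrow> bool" where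
  "influence_domain x I i n \<nu> \<longleftrightarrow>
     inj_on \<nu> {..<n} \<and> \<nu> ` {..<n} \<subseteq> {..I} \<and> i \<in> \<nu> ` {..<n} \<and>
     (\<forall>j \<in> \<nu> ` {..<n}. \<forall>m \<in> {..I} - \<nu> ` {..<n}. dist (x j) (x i) \<le> dist (x m) (x i))"

definition rbf_matrix :: "(real \<Rightarrow> real) \<Rightarrow> (nat \<Rightarrow> real) \<Rightarrow> nat \<Rightarrow> real mat" where
  "rbf_matrix \<phi> y n = Matrix.mat n n (\<lambda>(j, k). \<phi> (norm (y j - y k)))"

definition rbf_deriv_row :: "(real \<Rightarrow> real) \<Rightarrow> (nat \<Rightarrow> real) \<Rightarrow> nat \<Rightarrow> real \<Rightarrow> real mat" where
  "rbf_deriv_row \<phi> y n x0 = Matrix.mat 1 n (\<lambda>(_, k). deriv (\<lambda>x. \<phi> (norm (x - y k))) x0)"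

text \<open>The weights are only meaningful when the matrix is invertible, in which case
  \<^const>\<open>mat_inverse\<close> returns its inverse.\<close>

definition LRBF_weight ::
  "(real \<Rightarrow> real) \<Rightarrow> (nat \<Rightarrow> real) \<Rightarrow> nat \<Rightarrow> (nat \<Rightarrow> nat) \<Rightarrow> (nat \<Rightarrow> nat \<Rightarrow> nat) \<Rightarrow> nat \<Rightarrow> nat \<Rightarrow> real"
where
  "LRBF_weight \<phi> x I nn \<nu> i k =
     (if \<nu> i k \<in> {1..<I}
      then (rbf_deriv_row \<phi> (x \<circ> \<nu> i) (nn i) (x i)
              * the (mat_inverse (rbf_matrix \<phi> (x \<circ> \<nu> i) (nn i)))) $$ (0, k)
      else 0)"

section \<open>The midpoint method\<close>

text \<open>\<open>mid Y n\<close> is the half-level value of \<open>Y\<close> at \<open>n + 1/2\<close>.\<close>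

definition mid :: "(nat \<Rightarrow> 'b::real_vector) \<Rightarrow> nat \<Rightarrow> 'b" where
  "mid Y n = (1/2) *\<^sub>R (Y n + Y (Suc n))"

definition LRBF_midpoint_solution ::
  "(real \<Rightarrow> real) \<Rightarrow> (real \<Rightarrow> real) \<Rightarrow> real \<Rightarrow> nat \<Rightarrow> (nat \<Rightarrow> nat) \<Rightarrow> (nat \<Rightarrow> nat \<Rightarrow> nat)
     \<Rightarrow> (nat \<Rightarrow> nat \<Rightarrow> real) \<Rightarrow> (nat \<Rightarrow> nat \<Rightarrow> real)
     \<Rightarrow> (nat \<Rightarrow> nat \<Rightarrow> real) \<Rightarrow> (nat \<Rightarrow> nat \<Rightarrow> real) \<Rightarrow> (nat \<Rightarrow> nat \<Rightarrow> real) \<Rightarrow> bool" where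
  "LRBF_midpoint_solution f g dt I nn \<nu> d dW U V \<W> \<longleftrightarrow>
     (\<forall>n. U n 0 = 0 \<and> U n I = 0) \<and>
     (\<forall>n. \<forall>i\<in>{1..<I}.
        (U (Suc n) i - U n i) / dt = mid (\<lambda>m. V m i) n \<and>
        (\<Sum>k<nn i. d i k * mid (\<lambda>m. U m (\<nu> i k)) n) = mid (\<lambda>m. \<W> m i) n \<and>
        (V (Suc n) i - V n i) / dt =
          (\<Sum>k<nn i. d i k * mid (\<lambda>m. \<W> m (\<nu> i k)) n)
          - f (mid (\<lambda>m. U m i) n) + g (mid (\<lambda>m. U m i) n) * (dW n i / dt))"

section \<open>Differential forms on the parameter space\<close>

text \<open>A one-form (two-form) on the parameter space \<open>'p\<close> takes a base point and one (two) tangent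
  vectors; a vector of one-forms is indexed by the type \<^typ>\<open>3\<close>.\<close>

type_synonym 'p one_form = "'p \<Rightarrow> 'p \<Rightarrow> real"
type_synonym 'p two_form = "'p \<Rightarrow> 'p \<Rightarrow> 'p \<Rightarrow> real"

definition ext_d :: "('p::real_normed_vector \<Rightarrow> real) \<Rightarrow> 'p one_form" where
  "ext_d F p = frechet_derivative F (at p)"

definition ext_d_vec :: "('p::real_normed_vector \<Rightarrow> real^3) \<Rightarrow> 3 \<Rightarrow> 'p one_form" where
  "ext_d_vec F q = ext_d (\<lambda>p. vec_nth (F p) q)"

definition wedge :: "'p one_form \<Rightarrow> 'p one_form \<Rightarrow> 'p two_form" where
  "wedge \<alpha> \<beta> p \<xi> \<eta> = \<alpha> p \<xi> * \<beta> p \<eta> - \<alpha> p \<eta> * \<beta> p \<xi>"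

definition wedge_mat :: "(3 \<Rightarrow> 'p one_form) \<Rightarrow> real^3^3 \<Rightarrow> (3 \<Rightarrow> 'p one_form) \<Rightarrow> 'p two_form" where
  "wedge_mat a A b p \<xi> \<eta> =
     (\<Sum>r\<in>UNIV. \<Sum>s\<in>UNIV. vec_nth (vec_nth A r) s * wedge (a r) (b s) p \<xi> \<eta>)"

definition M_mat :: "real^3^3" where
  "M_mat = vector [vector [0, 1, 0], vector [-1, 0, 0], vector [0, 0, 0]]"

definition K_mat :: "real^3^3" where
  "K_mat = vector [vector [0, 0, -1], vector [0, 0, 0], vector [1, 0, 0]]"

text \<open>In the following, \<open>Z n i\<close> is the state at node \<open>i\<close> and level \<open>n\<close> as a function of the
  parameter, and \<open>j\<close> is a global node index.\<close>

definition omega_form :: "(nat \<Rightarrow> nat \<Rightarrow> 'p::real_normed_vector \<Rightarrow> real^3) \<Rightarrow> nat \<Rightarrow> nat \<Rightarrow> 'p two_form"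
where
  "omega_form Z n i p \<xi> \<eta> = (1/2) * wedge_mat (ext_d_vec (Z n i)) M_mat (ext_d_vec (Z n i)) p \<xi> \<eta>"

definition kappa_form ::
  "(nat \<Rightarrow> nat \<Rightarrow> 'p::real_normed_vector \<Rightarrow> real^3) \<Rightarrow> nat \<Rightarrow> nat \<Rightarrow> nat \<Rightarrow> 'p two_form" where
  "kappa_form Z n i j =
     wedge_mat (ext_d_vec (\<lambda>p. mid (\<lambda>m. Z m i p) n)) K_mat (ext_d_vec (\<lambda>p. mid (\<lambda>m. Z m j p) n))"

end

theory Submission
  imports Defs
begin

text \<open>Linearising the three equations of the scheme at a parameter point gives, for the differentials,
  \<open>\<delta>u = \<tau> v\<close>, \<open>\<Sum> d\<^sub>k u\<^sub>k = w\<close> and \<open>\<delta>v = \<tau> (\<Sum> d\<^sub>k w\<^sub>k - c u)\<close>, where \<open>\<tau>\<close> is the time step, \<open>\<delta>\<close> the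
  increment over one step, undecorated letters are values at the half level, and the scalar \<open>c\<close>
  collects \<open>f'\<close> and the noise term.
  The midpoint rule satisfies the exact discrete Leibniz rule
  \<open>\<delta>(u \<and> v) = \<delta>u \<and> v + u \<and> \<delta>v\<close>, so \<open>v \<and> v = 0\<close> and \<open>u \<and> c u = 0\<close> leave
  \<open>\<delta>\<omega>/\<tau> = \<Sum> d\<^sub>k u \<and> w\<^sub>k\<close>. On the other hand
  \<open>\<Sum> d\<^sub>k \<kappa>\<^sub>k = w \<and> \<Sum> d\<^sub>k u\<^sub>k - \<Sum> d\<^sub>k u \<and> w\<^sub>k\<close>, and the first term is \<open>w \<and> w = 0\<close>.\<close>

text \<open>This is the linearisation device: each equation of the scheme is an identity in the
  parameter on the open set \<open>D\<close>, so both sides agree near \<open>p\<close> and their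
  derivatives there coincide.\<close>

lemma has_derivative_unique_on_open:
  assumes "open S" "p \<in> S" "\<And>q. q \<in> S \<Longrightarrow> F q = G q"
    and F: "(F has_derivative F') (at p)" and G: "(G has_derivative G') (at p)"
  shows "F' = G'"
proof -
  have "(G has_derivative F') (at p)"
    using has_derivative_transform_within_open[OF F] assms(1-3) by blast
  then show ?thesis using G by (rule has_derivative_unique)
qed

lemma has_derivative_ext_d:
  "F differentiable (at p) \<Longrightarrow> (F has_derivative ext_d F p) (at p)"
  unfolding ext_d_def by (simp add: frechet_derivative_works)

lemma ext_d_eqI:
  "(F has_derivative F') (at p) \<Longrightarrow> ext_d F p = F'"
  unfolding ext_d_def by (rule frechet_derivative_at[symmetric])

lemma has_derivative_mid:
  assumes "\<And>m. (F m has_derivative F' m) (at p)"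
  shows "((\<lambda>q. mid (\<lambda>m. F m q) n) has_derivative (\<lambda>\<xi>. mid (\<lambda>m. F' m \<xi>) n)) (at p)"
  unfolding mid_def by (intro derivative_intros assms)

lemma ext_d_mid:
  assumes "\<And>m. F m differentiable (at p)"
  shows "ext_d (\<lambda>q. mid (\<lambda>m. F m q) n) p \<xi> = mid (\<lambda>m. ext_d (F m) p \<xi>) n"
  using ext_d_eqI[OF has_derivative_mid[OF has_derivative_ext_d[OF assms]]] by simp

lemma mid_vec_nth: "vec_nth (mid Y n) r = mid (\<lambda>m. vec_nth (Y m) r) n"
  by (simp add: mid_def)

text \<open>The entries 1 and -1 of \<open>M_mat\<close> contribute du \<and> dv - dv \<and> du = 2
  du \<and> dv, which the factor 1/2 in \<omega> normalises.\<close>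

lemma omega_form_vector:
  "omega_form (\<lambda>n i p. vector [U n i p, V n i p, Y n i p]) n i p \<xi> \<eta>
     = wedge (ext_d (U n i)) (ext_d (V n i)) p \<xi> \<eta>"
  by (simp add: omega_form_def wedge_mat_def M_mat_def sum_3 ext_d_vec_def wedge_def)

text \<open>Here the two entries of \<open>K_mat\<close> do not merge into one term, because the
  left factor lives at node \<open>i\<close> and the right one at node \<open>j\<close>.\<close>

lemma kappa_form_vector:
  "kappa_form (\<lambda>n i p. vector [U n i p, V n i p, Y n i p]) n i j p \<xi> \<eta>
     = wedge (ext_d (\<lambda>p. mid (\<lambda>m. Y m i p) n)) (ext_d (\<lambda>p. mid (\<lambda>m. U m j p) n)) p \<xi> \<eta>
       - wedge (ext_d (\<lambda>p. mid (\<lambda>m. U m i p) n)) (ext_d (\<lambda>p. mid (\<lambda>m. Y m j p) n)) p \<xi> \<eta>"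
  by (simp add: kappa_form_def wedge_mat_def K_mat_def sum_3 ext_d_vec_def mid_vec_nth)

text \<open>Discrete product rule: a1 b1 - a0 b0 equals (a1 - a0) times the mean of b plus the mean
  of a times (b1 - b0), with no remainder. It is applied to both products of the wedge.\<close>

lemma wedge_midpoint_Leibniz:
  fixes a b :: "nat \<Rightarrow> 'p \<Rightarrow> real"
  shows "(a (Suc n) \<xi> * b (Suc n) \<eta> - a (Suc n) \<eta> * b (Suc n) \<xi>) - (a n \<xi> * b n \<eta> - a n \<eta> * b n \<xi>)
    = ((a (Suc n) \<xi> - a n \<xi>) * mid (\<lambda>m. b m \<eta>) n - (a (Suc n) \<eta> - a n \<eta>) * mid (\<lambda>m. b m \<xi>) n)
    + (mid (\<lambda>m. a m \<xi>) n * (b (Suc n) \<eta> - b n \<eta>) - mid (\<lambda>m. a m \<eta>) n * (b (Suc n) \<xi> - b n \<xi>))"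
  by (simp add: mid_def field_simps)

text \<open>The algebraic core, with wedges written out on a pair of tangent vectors. Only
  \<open>u\<close> and \<open>v\<close> need their level index, since only they are differenced in
  time; \<open>uk\<close>, \<open>wk\<close> and \<open>w\<close> stand for half-level values. The
  coefficient \<open>c\<close> must be the same for both tangent vectors.\<close>

lemma multisymplectic_linearized:
  fixes u v :: "nat \<Rightarrow> 'p \<Rightarrow> real" and uk wk :: "nat \<Rightarrow> 'p \<Rightarrow> real"
  assumes u: "\<And>\<zeta>. (u (Suc n) \<zeta> - u n \<zeta>) / dt = mid (\<lambda>m. v m \<zeta>) n"
    and w: "\<And>\<zeta>. (\<Sum>k<N. d k * uk k \<zeta>) = w \<zeta>"
    and v: "\<And>\<zeta>. (v (Suc n) \<zeta> - v n \<zeta>) / dt = (\<Sum>k<N. d k * wk k \<zeta>) - c * mid (\<lambda>m. u m \<zeta>) n"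
  shows "((u (Suc n) \<xi> * v (Suc n) \<eta> - u (Suc n) \<eta> * v (Suc n) \<xi>) - (u n \<xi> * v n \<eta> - u n \<eta> * v n \<xi>)) / dt
    + (\<Sum>k<N. d k * ((w \<xi> * uk k \<eta> - w \<eta> * uk k \<xi>)
        - (mid (\<lambda>m. u m \<xi>) n * wk k \<eta> - mid (\<lambda>m. u m \<eta>) n * wk k \<xi>))) = 0"
proof -
  let ?u = "\<lambda>\<zeta>. mid (\<lambda>m. u m \<zeta>) n" and ?v = "\<lambda>\<zeta>. mid (\<lambda>m. v m \<zeta>) n"
  let ?s = "\<lambda>\<zeta>. \<Sum>k<N. d k * wk k \<zeta>"
  have "((u (Suc n) \<xi> * v (Suc n) \<eta> - u (Suc n) \<eta> * v (Suc n) \<xi>) - (u n \<xi> * v n \<eta> - u n \<eta> * v n \<xi>)) / dt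
    = ((u (Suc n) \<xi> - u n \<xi>) / dt * ?v \<eta> - (u (Suc n) \<eta> - u n \<eta>) / dt * ?v \<xi>)
      + (?u \<xi> * ((v (Suc n) \<eta> - v n \<eta>) / dt) - ?u \<eta> * ((v (Suc n) \<xi> - v n \<xi>) / dt))"
    unfolding wedge_midpoint_Leibniz by (simp add: add_divide_distrib diff_divide_distrib algebra_simps)
  \<comment> \<open>Antisymmetry cancels the products of \<open>?v\<close> with itself and,
    \<open>c\<close> being a scalar, those of \<open>?u\<close> with \<open>c\<close> times
    itself.\<close>
  also have "\<dots> = ?u \<xi> * ?s \<eta> - ?u \<eta> * ?s \<xi>"
    unfolding u v by (simp add: algebra_simps)
  finally have 1: "((u (Suc n) \<xi> * v (Suc n) \<eta> - u (Suc n) \<eta> * v (Suc n) \<xi>)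
      - (u n \<xi> * v n \<eta> - u n \<eta> * v n \<xi>)) / dt = ?u \<xi> * ?s \<eta> - ?u \<eta> * ?s \<xi>" .
  have "(\<Sum>k<N. d k * ((w \<xi> * uk k \<eta> - w \<eta> * uk k \<xi>) - (?u \<xi> * wk k \<eta> - ?u \<eta> * wk k \<xi>)))
    = (w \<xi> * (\<Sum>k<N. d k * uk k \<eta>) - w \<eta> * (\<Sum>k<N. d k * uk k \<xi>)) - (?u \<xi> * ?s \<eta> - ?u \<eta> * ?s \<xi>)"
    by (simp add: sum_distrib_left sum_subtractf[symmetric] algebra_simps)
  with 1 show ?thesis by (simp add: w)
qed

text \<open>Since \<open>f\<close> and \<open>g\<close> are themselves first derivatives of the
  potentials, differentiating them uses the case m = 1 of \<open>smooth\<close>.\<close>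

lemma smooth_deriv_has_real_derivative:
  assumes "smooth h"
  shows "(deriv h has_real_derivative deriv (deriv h) y) (at y)"
proof -
  have "(deriv ^^ 1) h differentiable_on UNIV"
    using assms unfolding smooth_def by blast
  then have "deriv h differentiable (at y)"
    by (simp add: differentiable_on_def)
  then show ?thesis
    by (simp add: field_differentiable_derivI real_differentiable_def field_differentiable_def)
qed

text \<open>The deterministic statement for one noise realisation: \<open>dW\<close> does not depend
  on the parameter, so it carries no differential.\<close>

lemma LRBF_midpoint_multisymplectic:
  fixes U V Y :: "nat \<Rightarrow> nat \<Rightarrow> 'p::real_normed_vector \<Rightarrow> real"
  assumes "open D" and p: "p \<in> D" and i: "i \<in> {1..<I}"
    and nodes: "\<And>k. k < nn i \<Longrightarrow> \<nu> i k \<le> I"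
    and f: "\<And>y. (f has_real_derivative f' y) (at y)"
    and g: "\<And>y. (g has_real_derivative g' y) (at y)"
    and diff: "\<And>n j. j \<le> I \<Longrightarrow> U n j differentiable (at p)"
      "\<And>n j. j \<le> I \<Longrightarrow> V n j differentiable (at p)"
      "\<And>n j. j \<le> I \<Longrightarrow> Y n j differentiable (at p)"
    and sol: "\<And>q. q \<in> D \<Longrightarrow> LRBF_midpoint_solution f g dt I nn \<nu> d dW
      (\<lambda>n i. U n i q) (\<lambda>n i. V n i q) (\<lambda>n i. Y n i q)"
    and Z: "Z = (\<lambda>n i p. vector [U n i p, V n i p, Y n i p])"
  shows "(omega_form Z (Suc n) i p \<xi> \<eta> - omega_form Z n i p \<xi> \<eta>) / dt
     + (\<Sum>k<nn i. d i k * kappa_form Z n i (\<nu> i k) p \<xi> \<eta>) = 0"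
proof -
  let ?N = "nn i"
  let ?u = "\<lambda>j m. ext_d (U m j) p" and ?v = "\<lambda>m. ext_d (V m i) p" and ?w = "\<lambda>j m. ext_d (Y m j) p"
  define um where "um j \<zeta> = mid (\<lambda>m. ?u j m \<zeta>) n" for j \<zeta>
  define wm where "wm j \<zeta> = mid (\<lambda>m. ?w j m \<zeta>) n" for j \<zeta>
  \<comment> \<open>The derivative of f(u) - g(u) dW/dt with respect to u, at the half-level value
    of u belonging to \<open>p\<close>.\<close>
  define c where "c = f' (mid (\<lambda>m. U m i p) n) - g' (mid (\<lambda>m. U m i p) n) * (dW n i / dt)"
  have iI: "i \<le> I" using i by simp
  have dU: "(U m j has_derivative ?u j m) (at p)" and dY: "(Y m j has_derivative ?w j m) (at p)"
    and dV: "(V m j has_derivative ext_d (V m j) p) (at p)" if "j \<le> I" for m j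
    using diff that by (auto intro: has_derivative_ext_d)
  have dUm: "((\<lambda>q. mid (\<lambda>m. U m j q) n) has_derivative um j) (at p)"
    and dYm: "((\<lambda>q. mid (\<lambda>m. Y m j q) n) has_derivative wm j) (at p)" if "j \<le> I" for j
    unfolding um_def wm_def by (intro has_derivative_mid dU dY that)+
  note lin = has_derivative_unique_on_open[OF \<open>open D\<close> p, THEN fun_cong]
  have u: "(?u i (Suc n) \<zeta> - ?u i n \<zeta>) / dt = mid (\<lambda>m. ?v m \<zeta>) n" for \<zeta>
  proof (rule lin)
    show "(U (Suc n) i q - U n i q) / dt = mid (\<lambda>m. V m i q) n" if "q \<in> D" for q
      using sol[OF that] i unfolding LRBF_midpoint_solution_def by blast
    show "((\<lambda>q. (U (Suc n) i q - U n i q) / dt) has_derivative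
        (\<lambda>\<zeta>. (?u i (Suc n) \<zeta> - ?u i n \<zeta>) / dt)) (at p)"
      using has_derivative_scaleR_right[OF has_derivative_diff[OF dU[OF iI, of "Suc n"] dU[OF iI, of n]], of "1/dt"]
      by (simp add: field_simps)
    show "((\<lambda>q. mid (\<lambda>m. V m i q) n) has_derivative (\<lambda>\<zeta>. mid (\<lambda>m. ?v m \<zeta>) n)) (at p)"
      by (intro has_derivative_mid dV iI)
  qed
  have w: "(\<Sum>k<?N. d i k * um (\<nu> i k) \<zeta>) = wm i \<zeta>" for \<zeta>
  proof (rule lin)
    show "(\<Sum>k<?N. d i k * mid (\<lambda>m. U m (\<nu> i k) q) n) = mid (\<lambda>m. Y m i q) n" if "q \<in> D" for q
      using sol[OF that] i unfolding LRBF_midpoint_solution_def by blast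
    show "((\<lambda>q. \<Sum>k<?N. d i k * mid (\<lambda>m. U m (\<nu> i k) q) n) has_derivative
        (\<lambda>\<zeta>. \<Sum>k<?N. d i k * um (\<nu> i k) \<zeta>)) (at p)"
      by (intro has_derivative_sum has_derivative_mult_right dUm nodes) simp
    show "((\<lambda>q. mid (\<lambda>m. Y m i q) n) has_derivative wm i) (at p)"
      by (intro dYm iI)
  qed
  have v: "(?v (Suc n) \<zeta> - ?v n \<zeta>) / dt
      = (\<Sum>k<?N. d i k * wm (\<nu> i k) \<zeta>) - c * mid (\<lambda>m. ?u i m \<zeta>) n" for \<zeta>
  proof (rule lin)
    show "(V (Suc n) i q - V n i q) / dt = (\<Sum>k<?N. d i k * mid (\<lambda>m. Y m (\<nu> i k) q) n)
        - f (mid (\<lambda>m. U m i q) n) + g (mid (\<lambda>m. U m i q) n) * (dW n i / dt)" if "q \<in> D" for q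
      using sol[OF that] i unfolding LRBF_midpoint_solution_def by blast
    show "((\<lambda>q. (V (Suc n) i q - V n i q) / dt) has_derivative
        (\<lambda>\<zeta>. (?v (Suc n) \<zeta> - ?v n \<zeta>) / dt)) (at p)"
      using has_derivative_scaleR_right[OF has_derivative_diff[OF dV[OF iI, of "Suc n"] dV[OF iI, of n]], of "1/dt"]
      by (simp add: field_simps)
    have S: "((\<lambda>q. \<Sum>k<?N. d i k * mid (\<lambda>m. Y m (\<nu> i k) q) n) has_derivative
        (\<lambda>\<zeta>. \<Sum>k<?N. d i k * wm (\<nu> i k) \<zeta>)) (at p)"
      by (intro has_derivative_sum has_derivative_mult_right dYm nodes) simp
    have F: "((\<lambda>q. f (mid (\<lambda>m. U m i q) n)) has_derivative
        (\<lambda>\<zeta>. f' (mid (\<lambda>m. U m i p) n) * um i \<zeta>)) (at p)"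
      using has_derivative_compose[OF dUm[OF iI] f[THEN has_field_derivative_imp_has_derivative]] .
    have G: "((\<lambda>q. g (mid (\<lambda>m. U m i q) n)) has_derivative
        (\<lambda>\<zeta>. g' (mid (\<lambda>m. U m i p) n) * um i \<zeta>)) (at p)"
      using has_derivative_compose[OF dUm[OF iI] g[THEN has_field_derivative_imp_has_derivative]] .
    \<comment> \<open>The right-hand form is what the derivative rules produce term by term; the
      left-hand form collects it under the single scalar \<open>c\<close>.\<close>
    have lin_eq: "(\<lambda>\<zeta>. (\<Sum>k<?N. d i k * wm (\<nu> i k) \<zeta>) - c * mid (\<lambda>m. ?u i m \<zeta>) n)
      = (\<lambda>\<zeta>. (\<Sum>k<?N. d i k * wm (\<nu> i k) \<zeta>) - f' (mid (\<lambda>m. U m i p) n) * um i \<zeta>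
          + g' (mid (\<lambda>m. U m i p) n) * um i \<zeta> * (dW n i / dt))"
      unfolding c_def um_def by (simp add: algebra_simps)
    show "((\<lambda>q. (\<Sum>k<?N. d i k * mid (\<lambda>m. Y m (\<nu> i k) q) n)
        - f (mid (\<lambda>m. U m i q) n) + g (mid (\<lambda>m. U m i q) n) * (dW n i / dt)) has_derivative
        (\<lambda>\<zeta>. (\<Sum>k<?N. d i k * wm (\<nu> i k) \<zeta>) - c * mid (\<lambda>m. ?u i m \<zeta>) n)) (at p)"
      unfolding lin_eq
      by (intro has_derivative_add has_derivative_diff has_derivative_mult_left S F G)
  qed
  \<comment> \<open>By linearity, the differential of a half-level value is the half-level value of
    the differentials.\<close>
  have kap: "kappa_form Z n i (\<nu> i k) p \<xi> \<eta>
      = (wm i \<xi> * um (\<nu> i k) \<eta> - wm i \<eta> * um (\<nu> i k) \<xi>)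
        - (um i \<xi> * wm (\<nu> i k) \<eta> - um i \<eta> * wm (\<nu> i k) \<xi>)" if "k < ?N" for k
    unfolding Z kappa_form_vector wedge_def
    by (simp add: ext_d_mid diff iI nodes[OF that] um_def wm_def)
  have om: "omega_form Z m i p \<xi> \<eta> = ?u i m \<xi> * ?v m \<eta> - ?u i m \<eta> * ?v m \<xi>" for m
    unfolding Z omega_form_vector wedge_def ..
  show ?thesis
    using multisymplectic_linearized[of "?u i" n dt ?v "d i" "\<lambda>k. um (\<nu> i k)" ?N "wm i"
        "\<lambda>k. wm (\<nu> i k)" c \<xi> \<eta>, OF u w v]
    by (simp add: om kap um_def[of i, symmetric])
qed

theorem theorem3p1:
  fixes ft gt f g \<phi> :: "real \<Rightarrow> real"
    and xL xR dt :: real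
    and I :: nat
    and nn :: "nat \<Rightarrow> nat"
    and \<nu> :: "nat \<Rightarrow> nat \<Rightarrow> nat"
    and x :: "nat \<Rightarrow> real"
    and d :: "nat \<Rightarrow> nat \<Rightarrow> real"
    and P :: "'w measure"
    and Q :: "(real \<Rightarrow> real) \<Rightarrow> real \<Rightarrow> real"
    and W :: "real \<Rightarrow> real \<Rightarrow> 'w \<Rightarrow> real"
    and D :: "'p::real_normed_vector set"
    and U V \<W> :: "nat \<Rightarrow> nat \<Rightarrow> 'w \<Rightarrow> 'p \<Rightarrow> real"
    and Z :: "'w \<Rightarrow> nat \<Rightarrow> nat \<Rightarrow> 'p \<Rightarrow> real^3"
  assumes "xL < xR" and "I \<ge> 1" and "dt > 0"
    and "smooth ft" and "smooth gt"
    and "f = deriv ft" and "g = deriv gt"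
    and "\<exists>L. L-lipschitz_on UNIV f" and "\<exists>L. L-lipschitz_on UNIV g"
    and "covariance_operator xL xR Q"
    and "Q_Wiener_process P xL xR Q W"
    and "x = grid_point xL xR I"
    and "\<And>i. i \<in> {1..<I} \<Longrightarrow> influence_domain x I i (nn i) (\<nu> i)"
    and "\<And>i k. i \<in> {1..<I} \<Longrightarrow> k < nn i \<Longrightarrow>
           (\<lambda>y. \<phi> (norm (y - x (\<nu> i k)))) differentiable (at (x i))"
    and "\<And>i. i \<in> {1..<I} \<Longrightarrow> invertible_mat (rbf_matrix \<phi> (x \<circ> \<nu> i) (nn i))"
    and "d = LRBF_weight \<phi> x I nn \<nu>"
    and "open D"
    and "AE \<omega> in P. \<forall>n. \<forall>i\<le>I. \<forall>p\<in>D.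
           U n i \<omega> differentiable (at p) \<and> V n i \<omega> differentiable (at p) \<and>
           \<W> n i \<omega> differentiable (at p)"
    and "AE \<omega> in P. \<forall>p\<in>D. LRBF_midpoint_solution f g dt I nn \<nu> d
           (\<lambda>n i. W (x i) (real (Suc n) * dt) \<omega> - W (x i) (real n * dt) \<omega>)
           (\<lambda>n i. U n i \<omega> p) (\<lambda>n i. V n i \<omega> p) (\<lambda>n i. \<W> n i \<omega> p)"
    and "Z = (\<lambda>\<omega> n i p. vector [U n i \<omega> p, V n i \<omega> p, \<W> n i \<omega> p])"
  shows "AE \<omega> in P. \<forall>i\<in>{1..<I}. \<forall>n. \<forall>p\<in>D. \<forall>\<xi> \<eta>.
           (omega_form (Z \<omega>) (Suc n) i p \<xi> \<eta> - omega_form (Z \<omega>) n i p \<xi> \<eta>) / dt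
           + (\<Sum>k<nn i. d i k * kappa_form (Z \<omega>) n i (\<nu> i k) p \<xi> \<eta>) = 0"
  \<comment> \<open>These are the two almost sure hypotheses. Their quantifiers over levels, nodes
    and parameters lie inside the \<open>AE\<close>, so one null set serves all \<open>i\<close>,
    \<open>n\<close> and \<open>p\<close>.\<close>
  using assms(18,19)
proof eventually_elim
  case (elim \<omega>)
  show ?case
  proof (intro ballI allI)
    fix i n p \<xi> \<eta>
    assume i: "i \<in> {1..<I}" and p: "p \<in> D"
    \<comment> \<open>An influence domain may contain the boundary indices 0 and \<open>I\<close>;
      differentiability is available there too.\<close>
    have nodes: "\<nu> i k \<le> I" if "k < nn i" for k
      using assms(13)[OF i] that unfolding influence_domain_def by blast
    have f: "(f has_real_derivative deriv f y) (at y)" and g: "(g has_real_derivative deriv g y) (at y)" for y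
      using smooth_deriv_has_real_derivative assms(4-7) by auto
    show "(omega_form (Z \<omega>) (Suc n) i p \<xi> \<eta> - omega_form (Z \<omega>) n i p \<xi> \<eta>) / dt
        + (\<Sum>k<nn i. d i k * kappa_form (Z \<omega>) n i (\<nu> i k) p \<xi> \<eta>) = 0"
      using elim p
      by (intro LRBF_midpoint_multisymplectic[where U = "\<lambda>n i. U n i \<omega>" and V = "\<lambda>n i. V n i \<omega>"
            and Y = "\<lambda>n i. \<W> n i \<omega>" and f = f and g = g and D = D and I = I
            and f' = "deriv f" and g' = "deriv g" and nn = nn and \<nu> = \<nu>
            and dW = "\<lambda>n i. W (x i) (real (Suc n) * dt) \<omega> - W (x i) (real n * dt) \<omega>",
            OF assms(17) p i nodes f g]) (auto simp: assms(20))
  qed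
qed

end
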